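(* Let $\mathbb{T}$ be a time scale, $\alpha\in(0,1]$, $a,b,c\in\mathbb{T}$, $\lambda\in\mathbb{R}$, and let $f,g$ be two rd-continuous functions $\mathbb{T}\to\mathbb{R}$. Then: (i) $\int_a^b[f(t)+g(t)]\,\Delta^\alpha t=\int_a^bf(t)\,\Delta^\alpha t+\int_a^bg(t)\,\Delta^\alpha t$; (ii) $\int_a^b(\lambda f)(t)\,\Delta^\alpha t=\lambda\int_a^bf(t)\,\Delta^\alpha t$; (iii) $\int_a^bf(t)\,\Delta^\alpha t=-\int_b^af(t)\,\Delta^\alpha t$; (iv) $\int_a^bf(t)\,\Delta^\alpha t=\int_a^cf(t)\,\Delta^\alpha t+\int_c^bf(t)\,\Delta^\alpha t$; (v) $\int_a^af(t)\,\Delta^\alpha t=0$; (vi) if there exists $g:\mathbb{T}\to\mathbb{R}$ with $|f(t)|\le g(t)$ for all $t\in[a,b]$, then $\left|\int_a^bf(t)\,\Delta^\alpha t\right|\le\int_a^bg(t)\,\Delta^\alpha t$; (vii) if $f(t)>0$ for all $t\in[a,b]$, then $\int_a^bf(t)\,\Delta^\alpha t\ge0$.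
   Context: A time scale $\mathbb{T}$ is a nonempty closed subset of $\mathbb{R}$; $\sigma(t)=\inf\{s\in\mathbb{T}:s>t\}$ (with $\inf\emptyset=\sup\mathbb{T}$). In (vi) and (vii), $[a,b]$ is the interval of points $t\in\mathbb{T}$ with $a\le t\le b$, where $a\le b$. A function $f:\mathbb{T}\to\mathbb{R}$ is rd-continuous if it is continuous at every right-dense point ($\sigma(t)=t$) and has finite left-sided limits at every left-dense point; it is regulated if it has finite right-sided limits at all right-dense points and finite left-sided limits at all left-dense points (rd-continuous functions are regulated). For a regulated function $f:\mathbb{T}\to\mathbb{R}$ and $0<\alpha\le1$, the $\alpha$-fractional integral is defined by $\int f(t)\,\Delta^\alpha t:=\int f(t)\,t^{\alpha-1}\,\Delta t$, the right-hand side being the usual indefinite delta integral of time-scale calculus. Writing $F_\alpha(t)=\int f(t)\,\Delta^\alpha t$, the Cauchy $\alpha$-fractional integral is defined, for all $a,b\in\mathbb{T}$, by $\int_a^bf(t)\,\Delta^\alpha t=F_\alpha(b)-F_\alpha(a)$.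
   Formalization: For α<1 the points a, b, c are assumed positive and the integral is taken over the points t>0 of the time scale, since t^{α−1} is undefined for t≤0; in (vi) the bounding function g is any regulated function, so that its integral is defined. *)

theory Defs
  imports "HOL-Analysis.Analysis"
begin

text \<open>
  A function \<open>T \<rightarrow> \<real>\<close> on a time scale is represented by a total function \<open>real \<Rightarrow> real\<close>;
  only its values on \<open>T\<close> matter in the notions below.
\<close>

definition time_scale :: "real set \<Rightarrow> bool" where
  "time_scale T \<longleftrightarrow> closed T \<and> T \<noteq> {}"

definition fwd_jump :: "real set \<Rightarrow> real \<Rightarrow> real" where
  "fwd_jump T t = (if {s \<in> T. s > t} = {} then Sup T else Inf {s \<in> T. s > t})"

definition bwd_jump :: "real set \<Rightarrow> real \<Rightarrow> real" where
  "bwd_jump T t = (if {s \<in> T. s < t} = {} then Inf T else Sup {s \<in> T. s < t})"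

definition right_dense :: "real set \<Rightarrow> real \<Rightarrow> bool" where
  "right_dense T t \<longleftrightarrow> fwd_jump T t = t"

definition left_dense :: "real set \<Rightarrow> real \<Rightarrow> bool" where
  "left_dense T t \<longleftrightarrow> bwd_jump T t = t"

text \<open>
  At a maximum (minimum) of \<open>T\<close> the filter of the right-sided (left-sided) limit is trivial,
  so the corresponding requirement below is vacuous there.
\<close>

definition has_right_limit :: "real set \<Rightarrow> (real \<Rightarrow> real) \<Rightarrow> real \<Rightarrow> bool" where
  "has_right_limit T f t \<longleftrightarrow> (\<exists>L. (f \<longlongrightarrow> L) (at t within (T \<inter> {t<..})))"

definition has_left_limit :: "real set \<Rightarrow> (real \<Rightarrow> real) \<Rightarrow> real \<Rightarrow> bool" where
  "has_left_limit T f t \<longleftrightarrow> (\<exists>L. (f \<longlongrightarrow> L) (at t within (T \<inter> {..<t})))"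

definition rd_continuous :: "real set \<Rightarrow> (real \<Rightarrow> real) \<Rightarrow> bool" where
  "rd_continuous T f \<longleftrightarrow>
     (\<forall>t\<in>T. right_dense T t \<longrightarrow> continuous (at t within T) f) \<and>
     (\<forall>t\<in>T. left_dense T t \<longrightarrow> has_left_limit T f t)"

definition regulated :: "real set \<Rightarrow> (real \<Rightarrow> real) \<Rightarrow> bool" where
  "regulated T f \<longleftrightarrow>
     (\<forall>t\<in>T. right_dense T t \<longrightarrow> has_right_limit T f t) \<and>
     (\<forall>t\<in>T. left_dense T t \<longrightarrow> has_left_limit T f t)"

text \<open>
  The set \<open>T\<^sup>\<kappa>\<close>: \<open>T\<close> without its maximum, if it has one and this maximum is left-scattered.
\<close>

definition ts_kappa :: "real set \<Rightarrow> real set" where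
  "ts_kappa T = {t \<in> T. \<not> ((\<forall>s\<in>T. s \<le> t) \<and> bwd_jump T t < t)}"

definition has_delta_derivative :: "real set \<Rightarrow> (real \<Rightarrow> real) \<Rightarrow> real \<Rightarrow> real \<Rightarrow> bool" where
  "has_delta_derivative T F d t \<longleftrightarrow>
     (\<forall>\<epsilon>>0. \<exists>\<delta>>0. \<forall>s\<in>T. \<bar>s - t\<bar> < \<delta> \<longrightarrow>
        \<bar>(F (fwd_jump T t) - F s) - d * (fwd_jump T t - s)\<bar> \<le> \<epsilon> * \<bar>fwd_jump T t - s\<bar>)"

text \<open>
  Bohner and Peterson's pre-antiderivatives: \<open>F\<close> is continuous on \<open>T\<close> and has delta derivative \<open>f\<close>
  on a set \<open>D \<subseteq> T\<^sup>\<kappa>\<close> such that \<open>T\<^sup>\<kappa> - D\<close> is countable and contains no right-scattered point.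
  Regulated functions have one, and it is unique up to an additive constant; the indefinite
  delta integral is some such \<open>F\<close>.
\<close>

definition pre_antiderivative :: "real set \<Rightarrow> (real \<Rightarrow> real) \<Rightarrow> (real \<Rightarrow> real) \<Rightarrow> bool" where
  "pre_antiderivative T f F \<longleftrightarrow>
     continuous_on T F \<and>
     (\<exists>D. D \<subseteq> ts_kappa T \<and> countable (ts_kappa T - D) \<and>
          (\<forall>t \<in> ts_kappa T - D. right_dense T t) \<and>
          (\<forall>t\<in>D. has_delta_derivative T F (f t) t))"

definition indef_delta_integral :: "real set \<Rightarrow> (real \<Rightarrow> real) \<Rightarrow> (real \<Rightarrow> real)" where
  "indef_delta_integral T f = (SOME F. pre_antiderivative T f F)"

text \<open>
  The points of \<open>T\<close> at which the real power \<open>t\<^bsup>\<alpha> - 1\<^esup>\<close> is defined, and its value there. For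
  \<open>\<alpha> < 1\<close> it needs \<open>t > 0\<close>; for \<open>\<alpha> = 1\<close> it is the constant \<open>1\<close>, so the integral is the delta
  integral on all of \<open>T\<close> (the case distinction is needed because \<open>0 powr 0 = 0\<close>). The integrand
  is integrated over this part of the time scale, which is all of \<open>T\<close> if \<open>T \<subseteq> {0<..}\<close> or \<open>\<alpha> = 1\<close>.
\<close>

definition frac_domain :: "real set \<Rightarrow> real \<Rightarrow> real set" where
  "frac_domain T \<alpha> = (if \<alpha> = 1 then T else T \<inter> {0<..})"

definition frac_weight :: "real \<Rightarrow> real \<Rightarrow> real" where
  "frac_weight \<alpha> t = (if \<alpha> = 1 then 1 else t powr (\<alpha> - 1))"

definition indef_frac_integral :: "real set \<Rightarrow> real \<Rightarrow> (real \<Rightarrow> real) \<Rightarrow> (real \<Rightarrow> real)" where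
  "indef_frac_integral T \<alpha> f =
     indef_delta_integral (frac_domain T \<alpha>) (\<lambda>t. f t * frac_weight \<alpha> t)"

definition frac_integral :: "real set \<Rightarrow> real \<Rightarrow> real \<Rightarrow> real \<Rightarrow> (real \<Rightarrow> real) \<Rightarrow> real" where
  "frac_integral T \<alpha> a b f = indef_frac_integral T \<alpha> f b - indef_frac_integral T \<alpha> f a"

end

theory Submission
  imports Defs
begin

text \<open>
  The indefinite integral is an arbitrary choice among the pre-antiderivatives of the weighted
  integrand \<open>f(t) t\<^sup>\<alpha>\<^sup>-\<^sup>1\<close>. Antisymmetry, additivity over intervals and the vanishing over a point hold for
  any choice whatever, as these integrals are differences of values of one function. The other
  claims need that a pre-antiderivative exists and that it is unique up to an additive constant.

  Uniqueness, and the two claims about inequalities, come from monotonicity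
  (\<open>pre_antiderivative_mono\<close>): a pre-antiderivative of a function that is nonnegative on \<open>[a, b]\<close> satisfies
  \<open>F a \<le> F b\<close>. Its proof looks at the last point at which \<open>F\<close>, made slightly steeper, is at least
  a level that it does not take at any of the countably many exceptional points. The bound on the absolute value then
  follows by applying it to \<open>h + f\<close> and \<open>h - f\<close>.

  Existence (\<open>pre_antiderivative_exists\<close>) is obtained from integration over the reals. A regulated function
  on the time scale is extended to a function that is constant on each gap of the time scale. The
  extension has one-sided limits everywhere in question, so it is integrable on compact intervals
  and has only countably many discontinuities; its ordinary indefinite integral, restricted to the
  time scale, has the right delta derivative outside of these.

  Given existence and uniqueness, linearity of the integral reflects that linear combinations of
  pre-antiderivatives are pre-antiderivatives of the linear combinations.
\<close>

section \<open>Functions with one-sided limits\<close>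

definition has_one_sided_limits :: "(real \<Rightarrow> real) \<Rightarrow> real \<Rightarrow> bool" where
  "has_one_sided_limits g x \<longleftrightarrow> (\<exists>L. (g \<longlongrightarrow> L) (at_left x)) \<and> (\<exists>R. (g \<longlongrightarrow> R) (at_right x))"

text \<open>
  Both consequences drawn below from one-sided limits, countably many discontinuities and
  integrability, use them only in this form: up to \<open>e\<close>, the function is a step function with a
  single jump near each point.
\<close>
lemma has_one_sided_limits_nearly_constant:
  assumes "has_one_sided_limits g x" and "0 < e"
  obtains L R d where "0 < d"
    and "\<And>y. \<lbrakk>x - d < y; y < x\<rbrakk> \<Longrightarrow> \<bar>g y - L\<bar> < e"
    and "\<And>y. \<lbrakk>x < y; y < x + d\<rbrakk> \<Longrightarrow> \<bar>g y - R\<bar> < e"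
proof -
  from assms(1) obtain L R where "(g \<longlongrightarrow> L) (at_left x)" "(g \<longlongrightarrow> R) (at_right x)"
    unfolding has_one_sided_limits_def by blast
  then have "\<forall>\<^sub>F y in at_left x. \<bar>g y - L\<bar> < e" "\<forall>\<^sub>F y in at_right x. \<bar>g y - R\<bar> < e"
    using assms(2) by (auto dest: tendstoD simp: dist_real_def)
  then obtain d1 d2
    where "d1 > 0" "\<And>y. y \<in> {..<x} \<Longrightarrow> y \<noteq> x \<Longrightarrow> dist y x < d1 \<Longrightarrow> \<bar>g y - L\<bar> < e"
      and "d2 > 0" "\<And>y. y \<in> {x<..} \<Longrightarrow> y \<noteq> x \<Longrightarrow> dist y x < d2 \<Longrightarrow> \<bar>g y - R\<bar> < e"
    unfolding eventually_at by blast
  then show thesis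
    by (intro that[of "min d1 d2" L R]) (auto simp: dist_real_def)
qed

text \<open>
  For fixed \<open>e\<close>, call a point rough if \<open>g\<close> varies by \<open>e\<close> or more in every neighbourhood of it. Immediately to the
  left and to the right of a point with one-sided limits the function is nearly constant, so such a
  point has a neighbourhood without further rough points. By the Lindelof property there are then only
  countably many of them for each \<open>e\<close>, and every discontinuity is rough for some \<open>e = 1 / (n + 1)\<close>.
\<close>
lemma countable_discontinuities:
  assumes "\<And>x. x \<in> A \<Longrightarrow> has_one_sided_limits g x"
  shows "countable {x \<in> A. \<not> isCont g x}"
proof -
  define rough where
    "rough e = {y. \<not> (\<exists>W. open W \<and> y \<in> W \<and> (\<forall>u\<in>W. \<forall>v\<in>W. \<bar>g u - g v\<bar> < e))}" for e
  have smooth: "y \<notin> rough e"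
    if "open W" "y \<in> W" "\<And>u v. \<lbrakk>u \<in> W; v \<in> W\<rbrakk> \<Longrightarrow> \<bar>g u - g v\<bar> < e" for e y W
    using that unfolding rough_def by blast
  have "countable (A \<inter> rough e)" if "0 < e" for e
  proof -
    have isolated: "\<exists>V. open V \<and> x \<in> V \<and> V \<inter> rough e \<subseteq> {x}" if "x \<in> A" for x
    proof -
      obtain L R d where "0 < d"
        and L: "\<And>y. \<lbrakk>x - d < y; y < x\<rbrakk> \<Longrightarrow> \<bar>g y - L\<bar> < e / 2"
        and R: "\<And>y. \<lbrakk>x < y; y < x + d\<rbrakk> \<Longrightarrow> \<bar>g y - R\<bar> < e / 2"
        using has_one_sided_limits_nearly_constant[OF assms[OF \<open>x \<in> A\<close>], of "e / 2"] \<open>0 < e\<close>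
        by (metis half_gt_zero)
      have left: "y \<notin> rough e" if "y \<in> {x - d<..<x}" for y
      proof (rule smooth[OF open_greaterThanLessThan that])
        fix u v assume "u \<in> {x - d<..<x}" "v \<in> {x - d<..<x}"
        then have "\<bar>g u - L\<bar> < e / 2" "\<bar>g v - L\<bar> < e / 2" using L by auto
        then show "\<bar>g u - g v\<bar> < e" by linarith
      qed
      have right: "y \<notin> rough e" if "y \<in> {x<..<x + d}" for y
      proof (rule smooth[OF open_greaterThanLessThan that])
        fix u v assume "u \<in> {x<..<x + d}" "v \<in> {x<..<x + d}"
        then have "\<bar>g u - R\<bar> < e / 2" "\<bar>g v - R\<bar> < e / 2" using R by auto
        then show "\<bar>g u - g v\<bar> < e" by linarith
      qed
      have "y = x" if "y \<in> {x - d<..<x + d} \<inter> rough e" for y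
        using that left[of y] right[of y] by (cases y x rule: linorder_cases) auto
      then have "{x - d<..<x + d} \<inter> rough e \<subseteq> {x}" by blast
      then show ?thesis
        using \<open>0 < d\<close> by (intro exI[of _ "{x - d<..<x + d}"]) auto
    qed
    define \<V> where "\<V> = {V. open V \<and> (\<exists>x. V \<inter> rough e \<subseteq> {x})}"
    obtain \<W> where \<W>: "\<W> \<subseteq> \<V>" "countable \<W>" "\<Union>\<W> = \<Union>\<V>"
      using Lindelof[of \<V>] by (metis (no_types, lifting) \<V>_def mem_Collect_eq)
    have "A \<inter> rough e \<subseteq> (\<Union>V\<in>\<W>. V \<inter> rough e)"
    proof
      fix x assume x: "x \<in> A \<inter> rough e"
      then have "x \<in> \<Union>\<V>" using isolated unfolding \<V>_def by blast
      then show "x \<in> (\<Union>V\<in>\<W>. V \<inter> rough e)" using x \<W>(3) by auto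
    qed
    moreover have "countable (V \<inter> rough e)" if "V \<in> \<W>" for V
    proof -
      obtain x where "V \<inter> rough e \<subseteq> {x}" using \<open>V \<in> \<W>\<close> \<W>(1) unfolding \<V>_def by blast
      then show ?thesis by (rule countable_subset) simp
    qed
    ultimately show ?thesis
      using \<W>(2) by (meson countable_UN countable_subset)
  qed
  moreover have "{x \<in> A. \<not> isCont g x} \<subseteq> (\<Union>n. A \<inter> rough (inverse (real (Suc n))))"
  proof
    fix x assume x: "x \<in> {x \<in> A. \<not> isCont g x}"
    show "x \<in> (\<Union>n. A \<inter> rough (inverse (real (Suc n))))"
    proof (rule ccontr)
      assume "x \<notin> (\<Union>n. A \<inter> rough (inverse (real (Suc n))))"
      then have W: "\<exists>W. open W \<and> x \<in> W \<and> (\<forall>u\<in>W. \<forall>v\<in>W. \<bar>g u - g v\<bar> < inverse (real (Suc n)))" for n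
        using x unfolding rough_def by blast
      have "\<forall>\<^sub>F y in at x. dist (g y) (g x) < e" if "0 < e" for e
      proof -
        obtain n where "inverse (real (Suc n)) < e"
          using reals_Archimedean[OF \<open>0 < e\<close>] by blast
        with W[of n] obtain W where "open W" "x \<in> W" "\<forall>u\<in>W. \<bar>g u - g x\<bar> < e"
          by (meson less_trans)
        then show ?thesis
          unfolding eventually_at_topological dist_real_def by blast
      qed
      then have "isCont g x" unfolding isCont_def by (rule tendstoI)
      with x show False by simp
    qed
  qed
  moreover have "countable (\<Union>n. A \<inter> rough (inverse (real (Suc n))))"
    using calculation(1) by (intro countable_UN) auto
  ultimately show ?thesis by (meson countable_subset)
qed

text \<open>
  Uniform limits of integrable functions are integrable, so it suffices to approximate \<open>g\<close> uniformly
  within each \<open>e\<close> by a step function. Around a single point two constants do, and by bisection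
  (Bolzano's lemma) local approximations combine to one on the whole interval.
\<close>
lemma integrable_on_if_one_sided_limits:
  assumes "\<And>x. \<lbrakk>a \<le> x; x \<le> b\<rbrakk> \<Longrightarrow> has_one_sided_limits g x"
  shows "g integrable_on {a..b}"
proof (cases "a \<le> b")
  case True
  define approx where
    "approx e u v \<longleftrightarrow> (\<exists>\<phi>. (\<forall>x\<in>{u..v}. \<bar>g x - \<phi> x\<bar> \<le> e) \<and> \<phi> integrable_on {u..v})" for e u v :: real
  have join: "approx e u w" if "approx e u v" "approx e v w" "u \<le> v" "v \<le> w" for e u v w
  proof -
    from that(1,2) obtain \<phi> \<psi> where \<phi>: "\<forall>x\<in>{u..v}. \<bar>g x - \<phi> x\<bar> \<le> e" "\<phi> integrable_on {u..v}"
      and \<psi>: "\<forall>x\<in>{v..w}. \<bar>g x - \<psi> x\<bar> \<le> e" "\<psi> integrable_on {v..w}"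
      unfolding approx_def by blast
    let ?\<chi> = "\<lambda>x. if x \<le> v then \<phi> x else \<psi> x"
    have "?\<chi> integrable_on {u..v}"
      by (rule integrable_spike_finite[OF _ _ \<phi>(2), of "{}"]) auto
    moreover have "?\<chi> integrable_on {v..w}"
      by (rule integrable_spike_finite[OF _ _ \<psi>(2), of "{v}"]) auto
    ultimately have "?\<chi> integrable_on {u..w}"
      by (rule Henstock_Kurzweil_Integration.integrable_combine[OF that(3,4)])
    moreover have "\<forall>x\<in>{u..w}. \<bar>g x - ?\<chi> x\<bar> \<le> e"
      using \<phi>(1) \<psi>(1) by auto
    ultimately show ?thesis
      unfolding approx_def by (intro exI[of _ ?\<chi>]) blast
  qed
  have const: "approx e u v" if "0 < e" "\<And>y. \<lbrakk>u < y; y < v\<rbrakk> \<Longrightarrow> \<bar>g y - c\<bar> < e" for e u v c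
  proof -
    \<comment> \<open>The end points are excluded from the hypothesis, so the approximant copies \<open>g\<close> there.\<close>
    let ?\<phi> = "\<lambda>x. if x = u \<or> x = v then g x else c"
    have "?\<phi> integrable_on {u..v}"
      by (rule integrable_spike_finite[of "{u, v}" _ _ "\<lambda>_. c"]) auto
    moreover have "\<forall>x\<in>{u..v}. \<bar>g x - ?\<phi> x\<bar> \<le> e"
      using that by (auto simp: less_eq_real_def)
    ultimately show ?thesis
      unfolding approx_def by (intro exI[of _ ?\<phi>]) blast
  qed
  have "approx e a b" if "0 < e" for e
    using True
  proof (induction rule: Bolzano)
    case (trans u v w)
    then show ?case using join by blast
  next
    case (local x)
    then obtain L R d where "0 < d"
      and L: "\<And>y. \<lbrakk>x - d < y; y < x\<rbrakk> \<Longrightarrow> \<bar>g y - L\<bar> < e"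
      and R: "\<And>y. \<lbrakk>x < y; y < x + d\<rbrakk> \<Longrightarrow> \<bar>g y - R\<bar> < e"
      using has_one_sided_limits_nearly_constant[OF assms \<open>0 < e\<close>] by metis
    have "approx e u v" if "u \<le> x" "x \<le> v" "v - u < d" for u v
      using that \<open>0 < e\<close> L R by (intro join[OF const[of e u x L] const[of e x v R]]) auto
    then show ?case
      using \<open>0 < d\<close> by blast
  qed
  then show ?thesis
    unfolding approx_def using integrable_uniform_limit_real[of a b g]
    by (metis box_real(2) real_norm_def)
qed (simp add: integrable_on_empty)

section \<open>Jumps and dense points\<close>

text \<open>
  The set of points \<open>t > 0\<close> of a time scale need not be closed, since points of the time scale may
  accumulate at \<open>0\<close>. Its only missing limit point is then its infimum, so it is still closed above
  each of its points, which is all the closedness that forward jumps and integrals between points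
  of the set require.
\<close>
definition closed_upwards :: "real set \<Rightarrow> bool" where
  "closed_upwards S \<longleftrightarrow> (\<forall>m\<in>S. closed (S \<inter> {m..}))"

lemma closed_upwards_segment:
  assumes "closed_upwards S" and "m \<in> S"
  shows "closed (S \<inter> {m..n})"
proof -
  have "S \<inter> {m..n} = (S \<inter> {m..}) \<inter> {..n}" by auto
  then show ?thesis using assms unfolding closed_upwards_def by (metis closed_Int closed_atMost)
qed

lemma fwd_jump_least:
  assumes "t < s" and "s \<in> S"
  shows "fwd_jump S t \<le> s"
proof -
  have "bdd_below {s \<in> S. s > t}" by (rule bdd_belowI[of _ t]) auto
  then have "Inf {s \<in> S. s > t} \<le> s" using assms by (intro cInf_lower) auto
  then show ?thesis using assms unfolding fwd_jump_def by auto
qed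

text \<open>
  A point without points of \<open>S\<close> above it counts as right-dense by convention, hence the hypothesis
  that there is some \<open>s\<close> above \<open>t\<close>.
\<close>
lemma right_dense_approach:
  assumes "right_dense S t" and "t < s" and "s \<in> S" and "t < u"
  obtains v where "v \<in> S" and "t < v" and "v < u"
proof (rule ccontr)
  assume "\<not> thesis"
  then have no: "\<And>v. \<lbrakk>v \<in> S; t < v\<rbrakk> \<Longrightarrow> u \<le> v" using that by force
  have "u \<le> Inf {s \<in> S. s > t}"
    by (rule cInf_greatest) (use assms no in auto)
  moreover have "fwd_jump S t = Inf {s \<in> S. s > t}"
    using assms unfolding fwd_jump_def by auto
  ultimately show False using assms unfolding right_dense_def by simp
qed

lemma right_scattered_jump:
  assumes "closed_upwards S" and "t \<in> S" and "\<not> right_dense S t"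
  shows "fwd_jump S t \<in> S" and "t < fwd_jump S t"
proof -
  let ?U = "{s \<in> S. s > t}"
  have ne: "?U \<noteq> {}"
  proof
    assume "?U = {}"
    then have "Sup S = t" using assms(2) by (intro cSup_eq_maximum) (auto simp: not_less)
    then show False using assms(3) \<open>?U = {}\<close> unfolding right_dense_def fwd_jump_def by simp
  qed
  then have jump: "fwd_jump S t = Inf ?U" unfolding fwd_jump_def by auto
  have "t \<le> Inf ?U" using ne by (intro cInf_greatest) auto
  then show gt: "t < fwd_jump S t" using assms(3) jump unfolding right_dense_def by simp
  have "?U = (S \<inter> {t..}) \<inter> {fwd_jump S t..}"
    using gt fwd_jump_least[of t _ S] by auto
  then have "closed ?U" using assms(1,2) unfolding closed_upwards_def by (metis closed_Int closed_atLeast)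
  moreover have "bdd_below ?U" by (rule bdd_belowI[of _ t]) auto
  ultimately show "fwd_jump S t \<in> S" using closed_contains_Inf[OF ne] jump by simp
qed

lemma ts_kappaI: "\<lbrakk>t \<in> S; s \<in> S; t < s\<rbrakk> \<Longrightarrow> t \<in> ts_kappa S"
  unfolding ts_kappa_def by force

section \<open>Monotonicity and uniqueness of pre-antiderivatives\<close>

text \<open>
  Suppose that \<open>F b < F a\<close>. Adding a small multiple of the identity gives a function \<open>H\<close> that still
  satisfies \<open>H b < H a\<close> but has positive delta derivative at all points of \<open>[a, b)\<close> outside the
  exceptional set. The exceptional points are countable, so some level \<open>y\<close> strictly between \<open>H b\<close> and \<open>H a\<close> is not taken by \<open>H\<close> at any
  of them. Let \<open>t\<close> be the last point of \<open>[a, b]\<close> at which \<open>H\<close> is at least \<open>y\<close>. If \<open>t\<close> is right-scattered,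
  then \<open>H\<close> does not decrease in the jump to its successor, which contradicts the choice of \<open>t\<close>. If it is
  right-dense, then \<open>H t = y\<close> by continuity, so \<open>t\<close> is not exceptional, and \<open>H\<close> increases just after \<open>t\<close>,
  again a contradiction.
\<close>
lemma pre_antiderivative_mono:
  assumes S: "closed_upwards S" and F: "pre_antiderivative S f F"
    and ab: "a \<in> S" "b \<in> S" "a \<le> b"
    and nonneg: "\<And>t. t \<in> S \<inter> {a..b} \<Longrightarrow> 0 \<le> f t"
  shows "F a \<le> F b"
proof (rule ccontr)
  assume "\<not> F a \<le> F b"
  then have less: "F b < F a" by simp
  then have "a < b" using ab(3) by (cases "a = b") auto
  obtain D where cont: "continuous_on S F" and D: "D \<subseteq> ts_kappa S" "countable (ts_kappa S - D)"
    "\<And>t. t \<in> ts_kappa S - D \<Longrightarrow> right_dense S t" "\<And>t. t \<in> D \<Longrightarrow> has_delta_derivative S F (f t) t"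
    using F unfolding pre_antiderivative_def by blast
  \<comment> \<open>With this slope the correction makes up for half of the drop from \<open>F a\<close> to \<open>F b\<close>.\<close>
  define \<epsilon> where "\<epsilon> = (F a - F b) / (2 * (b - a))"
  define H where "H t = F t + \<epsilon> * t" for t
  have "0 < \<epsilon>" using less \<open>a < b\<close> by (simp add: \<epsilon>_def)
  have "\<epsilon> * (b - a) = (F a - F b) / 2" using \<open>a < b\<close> by (simp add: \<epsilon>_def field_simps)
  then have "H b < H a" using less by (simp add: H_def algebra_simps)
  have contH: "continuous_on S H" unfolding H_def by (intro continuous_intros cont)
  obtain y where y: "H b < y" "y < H a" "y \<notin> H ` (ts_kappa S - D)"
    using real_interval_avoid_countable_set[OF \<open>H b < H a\<close> countable_image[OF D(2), of H]] by auto
  define K where "K = {s \<in> S \<inter> {a..b}. y \<le> H s}"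
  have "closed K"
    unfolding K_def
    by (rule continuous_on_closed_Collect_le)
      (use closed_upwards_segment[OF S ab(1), of b] continuous_on_subset[OF contH] in auto)
  moreover have "K \<noteq> {}" using ab y(2) by (auto simp: K_def)
  moreover have bddK: "bdd_above K" by (rule bdd_aboveI[of _ b]) (auto simp: K_def)
  ultimately have "Sup K \<in> K" by (intro closed_contains_Sup)
  define t where "t = Sup K"
  have t: "t \<in> S" "a \<le> t" "t \<le> b" "y \<le> H t"
    using \<open>Sup K \<in> K\<close> by (auto simp: t_def K_def)
  have "t < b" using t y(1) by (cases "t = b") auto
  have above: "H s < y" if "s \<in> S" "t < s" "s \<le> b" for s
  proof (rule ccontr)
    assume "\<not> H s < y"
    then have "s \<in> K" using that t by (auto simp: K_def)
    then have "s \<le> t" unfolding t_def using bddK by (rule cSup_upper)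
    then show False using that by simp
  qed
  have kappa: "t \<in> ts_kappa S" using ts_kappaI[OF t(1) ab(2) \<open>t < b\<close>] .
  have der: "\<exists>\<delta>>0. \<forall>s\<in>S. \<bar>s - t\<bar> < \<delta> \<longrightarrow>
      \<bar>(F (fwd_jump S t) - F s) - f t * (fwd_jump S t - s)\<bar> \<le> \<epsilon> / 2 * \<bar>fwd_jump S t - s\<bar>"
    if "t \<in> D"
    using D(4)[OF that] half_gt_zero[OF \<open>0 < \<epsilon>\<close>] unfolding has_delta_derivative_def by blast
  have f: "0 \<le> f t" using nonneg t by simp
  show False
  proof (cases "right_dense S t")
    case False
    let ?u = "fwd_jump S t"
    note jump = right_scattered_jump[OF S t(1) False]
    have "t \<in> D" using D(3) kappa False by blast
    from der[OF this] t(1) have "\<bar>(F ?u - F t) - f t * (?u - t)\<bar> \<le> \<epsilon> / 2 * \<bar>?u - t\<bar>"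
      by force
    moreover have "0 \<le> f t * (?u - t)" "0 < \<epsilon> * (?u - t)" using f jump \<open>0 < \<epsilon>\<close> by simp_all
    moreover have "H ?u - H t = (F ?u - F t) + \<epsilon> * (?u - t)" by (simp add: H_def algebra_simps)
    moreover have "\<epsilon> / 2 * \<bar>?u - t\<bar> = \<epsilon> * (?u - t) / 2" using jump by simp
    ultimately have "H t \<le> H ?u" by linarith
    moreover have "?u \<le> b" using fwd_jump_least \<open>t < b\<close> ab(2) .
    ultimately show False using above[of ?u] jump t(4) by simp
  next
    case True
    have "H t \<le> y"
    proof (rule ccontr)
      assume "\<not> H t \<le> y"
      moreover have "(H \<longlongrightarrow> H t) (at t within S)" using contH t(1) by (simp add: continuous_on)
      ultimately have "\<forall>\<^sub>F s in at t within S. y < H s" by (intro order_tendstoD) auto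
      then obtain d where "d > 0" and d: "\<And>s. \<lbrakk>s \<in> S; s \<noteq> t; dist s t < d\<rbrakk> \<Longrightarrow> y < H s"
        unfolding eventually_at by blast
      obtain s where "s \<in> S" "t < s" "s < min b (t + d)"
        using right_dense_approach[OF True \<open>t < b\<close> ab(2), of "min b (t + d)"] \<open>t < b\<close> \<open>d > 0\<close> by auto
      then show False using d[of s] above[of s] by (simp add: dist_real_def)
    qed
    then have "H t = y" using t(4) by simp
    then have "t \<in> D" using y(3) kappa by blast
    from der[OF this] obtain \<delta> where "\<delta> > 0" and \<delta>: "\<And>s. \<lbrakk>s \<in> S; \<bar>s - t\<bar> < \<delta>\<rbrakk> \<Longrightarrow>
        \<bar>(F t - F s) - f t * (t - s)\<bar> \<le> \<epsilon> / 2 * \<bar>t - s\<bar>"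
      using True unfolding right_dense_def by auto
    obtain s where s: "s \<in> S" "t < s" "s < min b (t + \<delta>)"
      using right_dense_approach[OF True \<open>t < b\<close> ab(2), of "min b (t + \<delta>)"] \<open>t < b\<close> \<open>\<delta> > 0\<close> by auto
    then have "\<bar>(F t - F s) - f t * (t - s)\<bar> \<le> \<epsilon> / 2 * \<bar>t - s\<bar>" by (intro \<delta>) auto
    moreover have "0 \<le> f t * (s - t)" "0 < \<epsilon> * (s - t)" using f s \<open>0 < \<epsilon>\<close> by simp_all
    moreover have "H s - H t = (F s - F t) + \<epsilon> * (s - t)" "f t * (t - s) = - (f t * (s - t))"
      by (simp_all add: H_def algebra_simps)
    moreover have "\<epsilon> / 2 * \<bar>t - s\<bar> = \<epsilon> * (s - t) / 2" using s by simp
    ultimately have "H t \<le> H s" by linarith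
    then show False using above[of s] s \<open>H t = y\<close> by simp
  qed
qed

lemma has_delta_derivative_linear_combination:
  assumes "has_delta_derivative T F c t" and "has_delta_derivative T G d t"
  shows "has_delta_derivative T (\<lambda>x. p * F x + q * G x) (p * c + q * d) t"
  unfolding has_delta_derivative_def
proof (intro allI impI)
  fix \<epsilon> :: real assume "0 < \<epsilon>"
  define \<eta> where "\<eta> = \<epsilon> / (\<bar>p\<bar> + \<bar>q\<bar> + 1)"
  have pos: "0 < \<bar>p\<bar> + \<bar>q\<bar> + 1" by linarith
  then have "0 < \<eta>" using \<open>0 < \<epsilon>\<close> by (simp add: \<eta>_def)
  have "(\<bar>p\<bar> + \<bar>q\<bar> + 1) * \<eta> = \<epsilon>" using pos by (simp add: \<eta>_def)
  then have \<eta>: "(\<bar>p\<bar> + \<bar>q\<bar>) * \<eta> \<le> \<epsilon>" using \<open>0 < \<eta>\<close> by (simp add: algebra_simps)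
  let ?u = "fwd_jump T t"
  obtain \<delta>1 where "\<delta>1 > 0"
    and F: "\<And>s. \<lbrakk>s \<in> T; \<bar>s - t\<bar> < \<delta>1\<rbrakk> \<Longrightarrow> \<bar>(F ?u - F s) - c * (?u - s)\<bar> \<le> \<eta> * \<bar>?u - s\<bar>"
    using assms(1) \<open>0 < \<eta>\<close> unfolding has_delta_derivative_def by blast
  obtain \<delta>2 where "\<delta>2 > 0"
    and G: "\<And>s. \<lbrakk>s \<in> T; \<bar>s - t\<bar> < \<delta>2\<rbrakk> \<Longrightarrow> \<bar>(G ?u - G s) - d * (?u - s)\<bar> \<le> \<eta> * \<bar>?u - s\<bar>"
    using assms(2) \<open>0 < \<eta>\<close> unfolding has_delta_derivative_def by blast
  show "\<exists>\<delta>>0. \<forall>s\<in>T. \<bar>s - t\<bar> < \<delta> \<longrightarrow>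
      \<bar>(p * F ?u + q * G ?u - (p * F s + q * G s)) - (p * c + q * d) * (?u - s)\<bar> \<le> \<epsilon> * \<bar>?u - s\<bar>"
  proof (intro exI[of _ "min \<delta>1 \<delta>2"] conjI ballI impI)
    fix s assume s: "s \<in> T" "\<bar>s - t\<bar> < min \<delta>1 \<delta>2"
    let ?A = "(F ?u - F s) - c * (?u - s)" and ?B = "(G ?u - G s) - d * (?u - s)"
    have "(p * F ?u + q * G ?u - (p * F s + q * G s)) - (p * c + q * d) * (?u - s) = p * ?A + q * ?B"
      by (simp add: algebra_simps)
    also have "\<bar>p * ?A + q * ?B\<bar> \<le> \<bar>p\<bar> * \<bar>?A\<bar> + \<bar>q\<bar> * \<bar>?B\<bar>"
      using abs_triangle_ineq[of "p * ?A" "q * ?B"] by (simp only: abs_mult)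
    also have "\<dots> \<le> \<bar>p\<bar> * (\<eta> * \<bar>?u - s\<bar>) + \<bar>q\<bar> * (\<eta> * \<bar>?u - s\<bar>)"
      using F[of s] G[of s] s by (intro add_mono mult_left_mono) auto
    also have "\<dots> = ((\<bar>p\<bar> + \<bar>q\<bar>) * \<eta>) * \<bar>?u - s\<bar>" by (simp add: algebra_simps)
    also have "\<dots> \<le> \<epsilon> * \<bar>?u - s\<bar>" using \<eta> by (intro mult_right_mono) auto
    finally show "\<bar>(p * F ?u + q * G ?u - (p * F s + q * G s)) - (p * c + q * d) * (?u - s)\<bar> \<le> \<epsilon> * \<bar>?u - s\<bar>" .
  qed (use \<open>\<delta>1 > 0\<close> \<open>\<delta>2 > 0\<close> in auto)
qed

lemma pre_antiderivative_linear_combination: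
  assumes "pre_antiderivative T f F" and "pre_antiderivative T g G"
  shows "pre_antiderivative T (\<lambda>t. p * f t + q * g t) (\<lambda>t. p * F t + q * G t)"
proof -
  obtain D where F: "continuous_on T F" "D \<subseteq> ts_kappa T" "countable (ts_kappa T - D)"
    "\<forall>t \<in> ts_kappa T - D. right_dense T t" "\<forall>t\<in>D. has_delta_derivative T F (f t) t"
    using assms(1) unfolding pre_antiderivative_def by blast
  obtain E where G: "continuous_on T G" "E \<subseteq> ts_kappa T" "countable (ts_kappa T - E)"
    "\<forall>t \<in> ts_kappa T - E. right_dense T t" "\<forall>t\<in>E. has_delta_derivative T G (g t) t"
    using assms(2) unfolding pre_antiderivative_def by blast
  show ?thesis
    unfolding pre_antiderivative_def
  proof (intro conjI exI[of _ "D \<inter> E"])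
    show "continuous_on T (\<lambda>t. p * F t + q * G t)" by (intro continuous_intros F G)
    show "countable (ts_kappa T - D \<inter> E)" using F(3) G(3) by (simp add: Diff_Int)
    show "\<forall>t\<in>D \<inter> E. has_delta_derivative T (\<lambda>t. p * F t + q * G t) (p * f t + q * g t) t"
      using F(5) G(5) by (auto intro: has_delta_derivative_linear_combination)
  qed (use F G in auto)
qed

text \<open>
  The difference of two pre-antiderivatives of \<open>f\<close>, taken in either order, has delta derivative \<open>0\<close>
  and is therefore monotone.
\<close>
lemma pre_antiderivative_unique:
  assumes "closed_upwards S" and "pre_antiderivative S f F" and "pre_antiderivative S f G"
    and "a \<in> S" and "b \<in> S"
  shows "F b - F a = G b - G a"
proof -
  have *: "F y - F x = G y - G x" if "x \<in> S" "y \<in> S" "x \<le> y" for x y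
    using pre_antiderivative_mono[OF assms(1) pre_antiderivative_linear_combination[OF assms(2,3), of 1 "-1"] that]
      pre_antiderivative_mono[OF assms(1) pre_antiderivative_linear_combination[OF assms(3,2), of 1 "-1"] that]
    by simp
  show ?thesis using *[of a b] *[of b a] assms(4,5) by linarith
qed

section \<open>Existence of pre-antiderivatives\<close>

definition ts_floor :: "real set \<Rightarrow> real \<Rightarrow> real" where
  "ts_floor S x = Sup {s \<in> S. s \<le> x}"

text \<open>
  The extension is constant on every gap \<open>[t, \<sigma>(t))\<close>, so that its ordinary integral over the gap is
  the contribution \<open>f(t) (\<sigma>(t) - t)\<close> of a right-scattered point to the delta integral. The value \<open>0\<close>
  below all of \<open>S\<close> is a default; it keeps the left limit at a minimum of \<open>S\<close> finite.
\<close>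
definition step_extension :: "real set \<Rightarrow> (real \<Rightarrow> real) \<Rightarrow> real \<Rightarrow> real" where
  "step_extension S f x = (if \<exists>s\<in>S. s \<le> x then f (ts_floor S x) else 0)"

lemma ts_floor_eq:
  assumes "t \<in> S" and "t \<le> x" and "\<And>s. \<lbrakk>s \<in> S; s \<le> x\<rbrakk> \<Longrightarrow> s \<le> t"
  shows "ts_floor S x = t"
  unfolding ts_floor_def using assms by (intro cSup_eq_maximum) auto

lemma step_extension_eq:
  assumes "t \<in> S" and "t \<le> x" and "\<And>s. \<lbrakk>s \<in> S; s \<le> x\<rbrakk> \<Longrightarrow> s \<le> t"
  shows "step_extension S f x = f t"
  using ts_floor_eq[OF assms] assms(1,2) unfolding step_extension_def by auto

lemma ts_floor_le:
  assumes "m \<in> S" and "m \<le> x"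
  shows "ts_floor S x \<le> x"
  unfolding ts_floor_def using assms by (intro cSup_least) auto

lemma ts_floor_ge:
  assumes "s \<in> S" and "s \<le> x"
  shows "s \<le> ts_floor S x"
  unfolding ts_floor_def using assms by (intro cSup_upper bdd_aboveI[of _ x]) auto

lemma ts_floor_in:
  assumes "closed_upwards S" and "m \<in> S" and "m \<le> x"
  shows "ts_floor S x \<in> S"
proof -
  let ?K = "S \<inter> {m..x}"
  have K: "?K \<noteq> {}" "bdd_above ?K" using assms by auto
  then have "Sup ?K \<in> ?K"
    by (intro closed_contains_Sup closed_upwards_segment[OF assms(1,2)])
  moreover have "s \<le> Sup ?K" if "s \<in> S" "s \<le> x" for s
  proof (cases "m \<le> s")
    case True
    then show ?thesis using that K(2) by (intro cSup_upper) auto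
  next
    case False
    then show ?thesis using \<open>Sup ?K \<in> ?K\<close> by auto
  qed
  ultimately have "ts_floor S x = Sup ?K" by (intro ts_floor_eq) auto
  then show ?thesis using \<open>Sup ?K \<in> ?K\<close> by auto
qed

lemma step_extension_cong:
  assumes "\<And>s. s \<in> S \<Longrightarrow> s \<le> x \<longleftrightarrow> s \<le> y"
  shows "step_extension S f x = step_extension S f y"
proof -
  have "{s \<in> S. s \<le> x} = {s \<in> S. s \<le> y}" using assms by blast
  then show ?thesis using assms unfolding step_extension_def ts_floor_def by auto
qed

lemma closed_upwards_limit_point:
  assumes "closed_upwards S" and "m \<in> S" and "\<And>e. 0 < e \<Longrightarrow> \<exists>s\<in>S. m \<le> s \<and> \<bar>s - x\<bar> < e"
  shows "x \<in> S"
proof -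
  have "closed (S \<inter> {m..})" using assms(1,2) unfolding closed_upwards_def by blast
  moreover have "\<forall>e>0. \<exists>s\<in>S \<inter> {m..}. dist s x < e"
    using assms(3) by (force simp: dist_real_def)
  ultimately show ?thesis using closed_approachable by blast
qed

text \<open>
  Either the extension is constant immediately to the left of \<open>x\<close>, or \<open>x\<close> is a limit of points of \<open>S\<close>
  from the left; in the latter case the largest point of \<open>S\<close> up to \<open>y\<close> tends to \<open>x\<close> as \<open>y\<close> does, and the
  limit is that of \<open>f\<close> along \<open>S\<close>. If \<open>S\<close> lies above \<open>x\<close>, the constant is \<open>0\<close>.
\<close>
lemma step_extension_left_limit:
  assumes S: "closed_upwards S" and lim: "\<And>t. t \<in> S \<Longrightarrow> has_left_limit S f t"
  shows "\<exists>L. (step_extension S f \<longlongrightarrow> L) (at_left x)"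
proof (cases "\<exists>e>0. \<forall>s\<in>S. \<not> (x - e < s \<and> s < x)")
  case True
  then obtain e where "e > 0" and gap: "\<And>s. s \<in> S \<Longrightarrow> \<not> (x - e < s \<and> s < x)" by blast
  have "step_extension S f y = step_extension S f (x - e / 2)" if "y \<in> {x - e<..<x}" for y
  proof (rule step_extension_cong)
    fix s assume "s \<in> S"
    then show "s \<le> y \<longleftrightarrow> s \<le> x - e / 2"
      using gap[of s] that \<open>e > 0\<close> by (auto simp: not_less)
  qed
  moreover have "\<forall>\<^sub>F y in at_left x. y \<in> {x - e<..<x}"
    using \<open>e > 0\<close> by (intro eventually_at_left_real) auto
  ultimately show ?thesis
    by (intro exI tendsto_eventually) (rule eventually_mono)
next
  case False
  then have acc: "\<exists>s\<in>S. x - e < s \<and> s < x" if "e > 0" for e using that by blast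
  obtain m where m: "m \<in> S" "m < x" using acc[of 1] by auto
  have near: "\<exists>s\<in>S. m \<le> s \<and> x - e < s \<and> s < x" if "e > 0" for e
  proof -
    have "0 < min e (x - m)" using that m by simp
    from acc[OF this] obtain s where "s \<in> S" "x - min e (x - m) < s" "s < x" by blast
    then show ?thesis by (intro bexI[of _ s]) auto
  qed
  have "x \<in> S" by (rule closed_upwards_limit_point[OF S m(1)]) (use near in force)
  then obtain L where L: "(f \<longlongrightarrow> L) (at x within (S \<inter> {..<x}))"
    using lim unfolding has_left_limit_def by blast
  have ev: "\<forall>\<^sub>F y in at_left x. y \<in> {m<..<x}" using m by (intro eventually_at_left_real)
  have "filterlim (ts_floor S) (at x within (S \<inter> {..<x})) (at_left x)"
    unfolding filterlim_at
  proof
    show "\<forall>\<^sub>F y in at_left x. ts_floor S y \<in> S \<inter> {..<x} \<and> ts_floor S y \<noteq> x"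
      using ev
    proof eventually_elim
      case (elim y)
      then show ?case using ts_floor_in[OF S m(1), of y] ts_floor_le[OF m(1), of y] by auto
    qed
    show "(ts_floor S \<longlongrightarrow> x) (at_left x)"
    proof (rule tendstoI)
      fix e :: real assume "e > 0"
      then obtain s where s: "s \<in> S" "m \<le> s" "x - e < s" "s < x" using near by blast
      have "\<forall>\<^sub>F y in at_left x. y \<in> {s<..<x}" using s by (intro eventually_at_left_real)
      then show "\<forall>\<^sub>F y in at_left x. dist (ts_floor S y) x < e"
      proof eventually_elim
        case (elim y)
        then show ?case
          using s ts_floor_ge[OF s(1), of y] ts_floor_le[OF s(1), of y] by (auto simp: dist_real_def)
      qed
    qed
  qed
  with L have "((\<lambda>y. f (ts_floor S y)) \<longlongrightarrow> L) (at_left x)" by (rule filterlim_compose)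
  moreover have "\<forall>\<^sub>F y in at_left x. f (ts_floor S y) = step_extension S f y"
    using ev
  proof eventually_elim
    case (elim y)
    then have "\<exists>s\<in>S. s \<le> y" using m by (intro bexI[of _ m]) auto
    then show ?case by (simp add: step_extension_def)
  qed
  ultimately have "(step_extension S f \<longlongrightarrow> L) (at_left x)" by (rule Lim_transform_eventually)
  then show ?thesis by blast
qed

text \<open>
  The point \<open>m\<close> excludes the infimum of \<open>S\<close> when it does not belong to \<open>S\<close>: \<open>f\<close> may be unbounded near it.
\<close>
lemma step_extension_right_limit:
  assumes S: "closed_upwards S" and m: "m \<in> S" "m \<le> x"
    and lim: "\<And>t. t \<in> S \<Longrightarrow> has_right_limit S f t"
  shows "\<exists>R. (step_extension S f \<longlongrightarrow> R) (at_right x)"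
proof (cases "\<exists>e>0. \<forall>s\<in>S. \<not> (x < s \<and> s < x + e)")
  case True
  then obtain e where "e > 0" and gap: "\<And>s. s \<in> S \<Longrightarrow> \<not> (x < s \<and> s < x + e)" by blast
  have "step_extension S f y = step_extension S f x" if "y \<in> {x<..<x + e}" for y
  proof (rule step_extension_cong)
    fix s assume "s \<in> S"
    then show "s \<le> y \<longleftrightarrow> s \<le> x"
      using gap[of s] that \<open>e > 0\<close> by (auto simp: not_less)
  qed
  moreover have "\<forall>\<^sub>F y in at_right x. y \<in> {x<..<x + e}"
    using \<open>e > 0\<close> by (intro eventually_at_right_real) auto
  ultimately show ?thesis
    by (intro exI tendsto_eventually) (rule eventually_mono)
next
  case False
  then have acc: "\<exists>s\<in>S. x < s \<and> s < x + e" if "e > 0" for e using that by blast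
  have "x \<in> S"
  proof (rule closed_upwards_limit_point[OF S m(1)])
    fix e :: real assume "0 < e"
    from acc[OF this] obtain s where "s \<in> S" "x < s" "s < x + e" by blast
    then show "\<exists>s\<in>S. m \<le> s \<and> \<bar>s - x\<bar> < e" using m(2) by (intro bexI[of _ s]) auto
  qed
  then obtain R where R: "(f \<longlongrightarrow> R) (at x within (S \<inter> {x<..}))"
    using lim unfolding has_right_limit_def by blast
  have between: "x < ts_floor S y \<and> ts_floor S y \<le> y" if "x < y" for y
  proof -
    obtain s where "s \<in> S" "x < s" "s < x + (y - x)" using acc[of "y - x"] \<open>x < y\<close> by auto
    then show ?thesis using ts_floor_ge[of s S y] ts_floor_le[of s S y] by auto
  qed
  have "filterlim (ts_floor S) (at x within (S \<inter> {x<..})) (at_right x)"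
    unfolding filterlim_at
  proof
    show "\<forall>\<^sub>F y in at_right x. ts_floor S y \<in> S \<inter> {x<..} \<and> ts_floor S y \<noteq> x"
      using eventually_at_right_less
    proof eventually_elim
      case (elim y)
      then show ?case using ts_floor_in[OF S m(1), of y] between[of y] m(2) by auto
    qed
    show "(ts_floor S \<longlongrightarrow> x) (at_right x)"
    proof (rule tendstoI)
      fix e :: real assume "e > 0"
      then have "\<forall>\<^sub>F y in at_right x. y \<in> {x<..<x + e}" by (intro eventually_at_right_real) simp
      then show "\<forall>\<^sub>F y in at_right x. dist (ts_floor S y) x < e"
      proof eventually_elim
        case (elim y)
        then show ?case using between[of y] by (auto simp: dist_real_def)
      qed
    qed
  qed
  with R have "((\<lambda>y. f (ts_floor S y)) \<longlongrightarrow> R) (at_right x)" by (rule filterlim_compose)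
  moreover have "\<forall>\<^sub>F y in at_right x. f (ts_floor S y) = step_extension S f y"
    using eventually_at_right_less
  proof eventually_elim
    case (elim y)
    then have "\<exists>s\<in>S. s \<le> y" using m by (intro bexI[of _ m]) auto
    then show ?case by (simp add: step_extension_def)
  qed
  ultimately have "(step_extension S f \<longlongrightarrow> R) (at_right x)" by (rule Lim_transform_eventually)
  then show ?thesis by blast
qed

text \<open>
  The ordinary indefinite integral \<open>F\<close> of the step extension \<open>g\<close> is a pre-antiderivative. At a
  right-scattered point the delta derivative is the difference quotient over the gap, where \<open>g\<close> is
  constant. At a right-dense point at which \<open>g\<close> is continuous it is the ordinary derivative. The
  remaining points are discontinuities of \<open>g\<close>, hence countably many.
\<close>
lemma pre_antiderivative_exists:
  assumes S: "closed_upwards S"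
    and lims: "\<And>t. t \<in> S \<Longrightarrow> has_left_limit S f t" "\<And>t. t \<in> S \<Longrightarrow> has_right_limit S f t"
  shows "\<exists>F. pre_antiderivative S f F"
proof (cases "S = {}")
  case True
  then show ?thesis unfolding pre_antiderivative_def ts_kappa_def by auto
next
  case False
  then obtain a where a: "a \<in> S" by blast
  define g where "g = step_extension S f"
  have g_eq: "g t = f t" if "t \<in> S" for t
    unfolding g_def using that by (intro step_extension_eq) auto
  have g_lim: "has_one_sided_limits g x" if "m \<in> S" "m \<le> x" for m x
    unfolding g_def has_one_sided_limits_def
    using step_extension_left_limit[OF S lims(1)] step_extension_right_limit[OF S that lims(2)] by blast
  have g_int: "g integrable_on {s..t}" if "s \<in> S" for s t
    using that by (intro integrable_on_if_one_sided_limits g_lim) auto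
  define F where "F t = (if a \<le> t then integral {a..t} g else - integral {t..a} g)" for t
  have F_diff: "F t - F s = integral {s..t} g" if st: "s \<in> S" "t \<in> S" "s \<le> t" for s t
  proof -
    have comb: "integral {u..v} g + integral {v..w} g = integral {u..w} g"
      if "u \<in> S" "u \<le> v" "v \<le> w" for u v w
      using Henstock_Kurzweil_Integration.integral_combine[OF that(2,3) g_int[OF that(1)]] .
    consider "a \<le> s" | "s < a" "a \<le> t" | "t < a" by linarith
    then show ?thesis
    proof cases
      case 1 then show ?thesis using comb[OF a, of s t] st by (simp add: F_def)
    next
      case 2 then show ?thesis using comb[OF st(1), of a t] by (simp add: F_def)
    next
      case 3 then show ?thesis using comb[OF st(1), of t a] st by (simp add: F_def)
    qed
  qed
  \<comment> \<open>Continuity of \<open>F\<close> comes from \<open>c = 0\<close>, the derivative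
       at a right-dense point from \<open>c = f t\<close> and small \<open>B\<close>, the increment over a gap from \<open>B = 0\<close>.\<close>
  have bound_le: "\<bar>(F t - F s) - c * (t - s)\<bar> \<le> B * (t - s)"
    if st: "s \<in> S" "t \<in> S" "s \<le> t" and B: "0 \<le> B" "\<And>x. \<lbrakk>s < x; x < t\<rbrakk> \<Longrightarrow> \<bar>g x - c\<bar> \<le> B"
    for s t c B
  proof -
    have "(g has_integral (F t - F s)) {s..t}"
      using g_int[OF st(1)] F_diff[OF st] by (simp add: integrable_integral)
    from has_integral_diff[OF this has_integral_const_real[of c s t]]
    have "((\<lambda>x. g x - c) has_integral ((F t - F s) - c * (t - s))) {s..t}"
      using st(3) by (simp add: mult.commute)
    then have "norm ((F t - F s) - c * (t - s)) \<le> B * measure lborel {s..t}"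
      using B by (intro has_integral_bound_real[where S = "{s, t}"]) auto
    then show ?thesis using st(3) by simp
  qed
  have bound: "\<bar>(F t - F s) - c * (t - s)\<bar> \<le> B * \<bar>t - s\<bar>"
    if st: "s \<in> S" "t \<in> S" and B: "0 \<le> B"
      "\<And>x. \<lbrakk>\<bar>x - t\<bar> < \<bar>s - t\<bar>; x \<noteq> t\<rbrakk> \<Longrightarrow> \<bar>g x - c\<bar> \<le> B" for s t c B
  proof (cases "s \<le> t")
    case True
    then have "\<bar>(F t - F s) - c * (t - s)\<bar> \<le> B * (t - s)" using st B by (intro bound_le) auto
    then show ?thesis using True by simp
  next
    case False
    then have "\<bar>(F s - F t) - c * (s - t)\<bar> \<le> B * (s - t)" using st B by (intro bound_le) auto
    moreover have "(F s - F t) - c * (s - t) = - ((F t - F s) - c * (t - s))" by (simp add: algebra_simps)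
    ultimately show ?thesis using False by simp
  qed
  have cont: "continuous (at t within S) F" if t: "t \<in> S" for t
  proof -
    obtain L R d where "0 < d"
      and L: "\<And>y. \<lbrakk>t - d < y; y < t\<rbrakk> \<Longrightarrow> \<bar>g y - L\<bar> < 1"
      and R: "\<And>y. \<lbrakk>t < y; y < t + d\<rbrakk> \<Longrightarrow> \<bar>g y - R\<bar> < 1"
      using has_one_sided_limits_nearly_constant[OF g_lim[OF t order_refl] zero_less_one] by metis
    define B where "B = \<bar>L\<bar> + \<bar>R\<bar> + 1"
    have "norm (F s - F t) \<le> B * \<bar>s - t\<bar>" if "s \<in> S" "\<bar>s - t\<bar> < d" for s
    proof -
      have "\<bar>g x - 0\<bar> \<le> B" if "\<bar>x - t\<bar> < \<bar>s - t\<bar>" "x \<noteq> t" for x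
        using L[of x] R[of x] that \<open>\<bar>s - t\<bar> < d\<close> unfolding B_def by (cases "x < t") linarith+
      then have "\<bar>(F t - F s) - 0 * (t - s)\<bar> \<le> B * \<bar>t - s\<bar>"
        using that t by (intro bound) (auto simp: B_def)
      then show ?thesis by (simp add: abs_minus_commute)
    qed
    then have "\<forall>\<^sub>F s in at t within S. norm (F s - F t) \<le> B * \<bar>s - t\<bar>"
      using \<open>0 < d\<close> unfolding eventually_at by (intro exI[of _ d]) (simp add: dist_real_def)
    moreover have "((\<lambda>s. B * \<bar>s - t\<bar>) \<longlongrightarrow> B * \<bar>t - t\<bar>) (at t within S)"
      by (intro tendsto_intros)
    then have "((\<lambda>s. B * \<bar>s - t\<bar>) \<longlongrightarrow> 0) (at t within S)" by simp
    ultimately have "((\<lambda>s. F s - F t) \<longlongrightarrow> 0) (at t within S)"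
      by (rule Lim_null_comparison)
    then show ?thesis unfolding continuous_within by (rule LIM_zero_cancel)
  qed
  define D where "D = {t \<in> ts_kappa S. \<not> right_dense S t \<or> isCont g t}"
  have "has_delta_derivative S F (f t) t" if "t \<in> D" for t
    unfolding has_delta_derivative_def
  proof (intro allI impI)
    fix \<epsilon> :: real assume "0 < \<epsilon>"
    have t: "t \<in> S" using that by (auto simp: D_def ts_kappa_def)
    show "\<exists>\<delta>>0. \<forall>s\<in>S. \<bar>s - t\<bar> < \<delta> \<longrightarrow>
        \<bar>(F (fwd_jump S t) - F s) - f t * (fwd_jump S t - s)\<bar> \<le> \<epsilon> * \<bar>fwd_jump S t - s\<bar>"
    proof (cases "right_dense S t")
      case True
      then have "isCont g t" using that by (simp add: D_def)
      then have "\<exists>\<delta>>0. \<forall>x. x \<noteq> t \<and> \<bar>x - t\<bar> < \<delta> \<longrightarrow> \<bar>g x - f t\<bar> < \<epsilon>"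
        using \<open>0 < \<epsilon>\<close> unfolding isCont_def LIM_eq g_eq[OF t] by simp
      then obtain \<delta> where "\<delta> > 0" and \<delta>: "\<And>x. \<lbrakk>x \<noteq> t; \<bar>x - t\<bar> < \<delta>\<rbrakk> \<Longrightarrow> \<bar>g x - f t\<bar> < \<epsilon>"
        by blast
      have "\<bar>(F t - F s) - f t * (t - s)\<bar> \<le> \<epsilon> * \<bar>t - s\<bar>" if "s \<in> S" "\<bar>s - t\<bar> < \<delta>" for s
        using that t \<open>0 < \<epsilon>\<close> \<delta> by (intro bound) (auto intro: less_imp_le)
      then show ?thesis using True \<open>\<delta> > 0\<close> unfolding right_dense_def by auto
    next
      case False
      let ?u = "fwd_jump S t"
      note jump = right_scattered_jump[OF S t False]
      have "g x = f t" if "t < x" "x < ?u" for x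
        unfolding g_def
      proof (rule step_extension_eq[OF t])
        fix s assume "s \<in> S" "s \<le> x"
        then show "s \<le> t" using fwd_jump_least[of t s S] that by force
      qed (use that in simp)
      then have "\<bar>(F ?u - F t) - f t * (?u - t)\<bar> \<le> 0 * (?u - t)"
        using jump t by (intro bound_le) auto
      then have eq: "F ?u - F t = f t * (?u - t)" by simp
      \<comment> \<open>For \<open>s\<close> near \<open>t\<close> the distance from \<open>s\<close> to the successor stays at least
          half of the gap, so that continuity at \<open>t\<close> controls the error.\<close>
      have "((\<lambda>s. F s - f t * s) \<longlongrightarrow> F t - f t * t) (at t within S)"
        using cont[OF t] unfolding continuous_within by (intro tendsto_intros)
      then have "\<forall>\<^sub>F s in at t within S. dist (F s - f t * s) (F t - f t * t) < \<epsilon> * ((?u - t) / 2)"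
        by (rule tendstoD) (use \<open>0 < \<epsilon>\<close> jump in simp)
      then obtain d where "d > 0" and d: "\<And>s. \<lbrakk>s \<in> S; s \<noteq> t; \<bar>s - t\<bar> < d\<rbrakk> \<Longrightarrow>
          \<bar>(F s - f t * s) - (F t - f t * t)\<bar> < \<epsilon> * ((?u - t) / 2)"
        unfolding eventually_at dist_real_def by blast
      show ?thesis
      proof (intro exI[of _ "min d ((?u - t) / 2)"] conjI ballI impI)
        fix s assume s: "s \<in> S" "\<bar>s - t\<bar> < min d ((?u - t) / 2)"
        have "(F ?u - F s) - f t * (?u - s) = - ((F s - f t * s) - (F t - f t * t))"
          using eq by (simp add: algebra_simps)
        then have "\<bar>(F ?u - F s) - f t * (?u - s)\<bar> = \<bar>(F s - f t * s) - (F t - f t * t)\<bar>" by simp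
        also have "\<dots> \<le> \<epsilon> * ((?u - t) / 2)"
          using d[of s] s \<open>0 < \<epsilon>\<close> jump by (cases "s = t") auto
        also have "\<dots> \<le> \<epsilon> * \<bar>?u - s\<bar>"
        proof (rule mult_left_mono)
          have "\<bar>s - t\<bar> < (?u - t) / 2" using s by simp
          then show "(?u - t) / 2 \<le> \<bar>?u - s\<bar>" by argo
        qed (use \<open>0 < \<epsilon>\<close> in simp)
        finally show "\<bar>(F ?u - F s) - f t * (?u - s)\<bar> \<le> \<epsilon> * \<bar>?u - s\<bar>" .
      qed (use \<open>d > 0\<close> jump in auto)
    qed
  qed
  moreover have "countable (ts_kappa S - D)"
  proof (rule countable_subset)
    show "ts_kappa S - D \<subseteq> {x \<in> S. \<not> isCont g x}" by (auto simp: D_def ts_kappa_def)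
    show "countable {x \<in> S. \<not> isCont g x}" using g_lim by (intro countable_discontinuities) blast
  qed
  moreover have "continuous_on S F"
    using cont by (simp add: continuous_on_eq_continuous_within)
  ultimately show ?thesis
    unfolding pre_antiderivative_def
    by (intro exI[of _ F] conjI exI[of _ D]) (auto simp: D_def)
qed

section \<open>The fractional integral\<close>

lemma closed_upwards_frac_domain:
  assumes "closed T"
  shows "closed_upwards (frac_domain T \<alpha>)"
  unfolding closed_upwards_def
proof
  fix m assume "m \<in> frac_domain T \<alpha>"
  then have "frac_domain T \<alpha> \<inter> {m..} = T \<inter> {m..}" by (auto simp: frac_domain_def split: if_splits)
  then show "closed (frac_domain T \<alpha> \<inter> {m..})" using assms by (simp add: closed_Int)
qed

lemma not_right_dense_at_within:
  assumes "\<not> right_dense T t"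
  shows "at t within (T \<inter> {t<..}) = bot"
proof (cases "{s \<in> T. t < s} = {}")
  case True
  then have "T \<inter> {t<..} = {}" by auto
  then show ?thesis by simp
next
  case False
  then have jump: "fwd_jump T t = Inf {s \<in> T. s > t}" unfolding fwd_jump_def by auto
  have "t \<le> Inf {s \<in> T. s > t}" using False by (intro cInf_greatest) auto
  then have gt: "t < fwd_jump T t" using assms jump unfolding right_dense_def by simp
  have "\<forall>\<^sub>F s in at t within (T \<inter> {t<..}). False"
    unfolding eventually_at
  proof (intro exI[of _ "fwd_jump T t - t"] conjI ballI impI)
    fix s assume "s \<in> T \<inter> {t<..}" "s \<noteq> t \<and> dist s t < fwd_jump T t - t"
    then show False using fwd_jump_least[of t s T] by (auto simp: dist_real_def)
  qed (use gt in simp)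
  then show ?thesis by (simp add: trivial_limit_def)
qed

lemma not_left_dense_at_within:
  assumes "\<not> left_dense T t"
  shows "at t within (T \<inter> {..<t}) = bot"
proof (cases "{s \<in> T. s < t} = {}")
  case True
  then have "T \<inter> {..<t} = {}" by auto
  then show ?thesis by simp
next
  case False
  then have jump: "bwd_jump T t = Sup {s \<in> T. s < t}" unfolding bwd_jump_def by auto
  have "Sup {s \<in> T. s < t} \<le> t" using False by (intro cSup_least) auto
  then have gt: "bwd_jump T t < t" using assms jump unfolding left_dense_def by simp
  have "\<forall>\<^sub>F s in at t within (T \<inter> {..<t}). False"
    unfolding eventually_at
  proof (intro exI[of _ "t - bwd_jump T t"] conjI ballI impI)
    fix s assume s: "s \<in> T \<inter> {..<t}" "s \<noteq> t \<and> dist s t < t - bwd_jump T t"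
    then have "s \<le> bwd_jump T t"
      unfolding jump by (intro cSup_upper bdd_aboveI[of _ t]) auto
    then show False using s by (auto simp: dist_real_def)
  qed (use gt in simp)
  then show ?thesis by (simp add: trivial_limit_def)
qed

text \<open>
  At a point that is not right-dense (left-dense) the filter of the right-sided (left-sided) limit is
  trivial, so the restriction to dense points in the definition can be lifted. In this form the property
  passes to subsets, although a point can be left-dense in a subset without being so in \<open>T\<close>.
\<close>
lemma regulated_iff_one_sided_limits:
  "regulated T f \<longleftrightarrow> (\<forall>t\<in>T. has_right_limit T f t \<and> has_left_limit T f t)"
  unfolding regulated_def has_right_limit_def has_left_limit_def
  by (metis not_left_dense_at_within not_right_dense_at_within tendsto_bot)

lemma rd_continuous_imp_regulated:
  assumes "rd_continuous T f"
  shows "regulated T f"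
proof -
  have "has_right_limit T f t" if "continuous (at t within T) f" for t
  proof -
    have "(f \<longlongrightarrow> f t) (at t within (T \<inter> {t<..}))"
      using that unfolding continuous_within by (rule tendsto_within_subset) auto
    then show ?thesis unfolding has_right_limit_def by blast
  qed
  then show ?thesis using assms unfolding rd_continuous_def regulated_def by blast
qed

lemma isCont_frac_weight:
  assumes "\<alpha> = 1 \<or> 0 < t"
  shows "isCont (frac_weight \<alpha>) t"
proof (cases "\<alpha> = 1")
  case True
  then show ?thesis by (simp add: frac_weight_def[abs_def])
next
  case False
  then have "frac_weight \<alpha> = (\<lambda>t. t powr (\<alpha> - 1))" by (simp add: frac_weight_def[abs_def])
  then show ?thesis using assms False by (auto intro!: continuous_intros)
qed

lemma frac_weight_nonneg: "0 \<le> frac_weight \<alpha> t"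
  by (simp add: frac_weight_def)

text \<open>
  The weight is continuous on the domain of the fractional integral, so the weighted integrand
  keeps its one-sided limits there and the choice in the definition of the indefinite
  integral is from a nonempty set.
\<close>
lemma indef_frac_integral_pre_antiderivative:
  assumes "closed T" and "regulated T f"
  shows "pre_antiderivative (frac_domain T \<alpha>) (\<lambda>t. f t * frac_weight \<alpha> t) (indef_frac_integral T \<alpha> f)"
proof -
  let ?S = "frac_domain T \<alpha>" and ?h = "\<lambda>t. f t * frac_weight \<alpha> t"
  have one_sided: "\<exists>L. (?h \<longlongrightarrow> L) (at t within (?S \<inter> J))"
    if "t \<in> ?S" "\<exists>L. (f \<longlongrightarrow> L) (at t within (T \<inter> J))" for t J
  proof -
    from that(2) obtain L where "(f \<longlongrightarrow> L) (at t within (T \<inter> J))" by blast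
    then have "(f \<longlongrightarrow> L) (at t within (?S \<inter> J))"
      by (rule tendsto_within_subset) (auto simp: frac_domain_def split: if_splits)
    moreover have "isCont (frac_weight \<alpha>) t"
      using that(1) by (intro isCont_frac_weight) (auto simp: frac_domain_def split: if_splits)
    then have "(frac_weight \<alpha> \<longlongrightarrow> frac_weight \<alpha> t) (at t within (?S \<inter> J))"
      unfolding isCont_def by (rule tendsto_within_subset) simp
    ultimately show ?thesis by (blast intro: tendsto_mult)
  qed
  have "?S \<subseteq> T" by (simp add: frac_domain_def)
  then have "\<exists>F. pre_antiderivative ?S ?h F"
    using assms one_sided
    by (intro pre_antiderivative_exists closed_upwards_frac_domain)
      (auto simp: regulated_iff_one_sided_limits has_left_limit_def has_right_limit_def)
  then show ?thesis
    unfolding indef_frac_integral_def indef_delta_integral_def by (rule someI_ex)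
qed

text \<open>
  By uniqueness, the Cauchy integral may be computed from any pre-antiderivative of the weighted
  integrand in place of the chosen one.
\<close>
lemma frac_integral_eq:
  assumes "closed T" and "regulated T f"
    and "pre_antiderivative (frac_domain T \<alpha>) (\<lambda>t. f t * frac_weight \<alpha> t) F"
    and "a \<in> frac_domain T \<alpha>" and "b \<in> frac_domain T \<alpha>"
  shows "frac_integral T \<alpha> a b f = F b - F a"
  unfolding frac_integral_def
  using pre_antiderivative_unique[OF closed_upwards_frac_domain[OF assms(1)]
      indef_frac_integral_pre_antiderivative[OF assms(1,2)] assms(3,4,5)] .

lemma regulated_linear_combination:
  assumes "regulated T f" and "regulated T g"
  shows "regulated T (\<lambda>t. p * f t + q * g t)"
proof -
  have "\<exists>L. ((\<lambda>t. p * f t + q * g t) \<longlongrightarrow> L) X"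
    if "\<exists>L. (f \<longlongrightarrow> L) X" "\<exists>L. (g \<longlongrightarrow> L) X" for X
  proof -
    obtain L M where "(f \<longlongrightarrow> L) X" "(g \<longlongrightarrow> M) X"
      using \<open>\<exists>L. (f \<longlongrightarrow> L) X\<close> \<open>\<exists>L. (g \<longlongrightarrow> L) X\<close> by blast
    then have "((\<lambda>t. p * f t + q * g t) \<longlongrightarrow> p * L + q * M) X" by (intro tendsto_intros)
    then show ?thesis by blast
  qed
  then show ?thesis
    using assms unfolding regulated_def has_right_limit_def has_left_limit_def by simp
qed

lemma frac_integral_linear_combination:
  assumes "closed T" and "regulated T f" and "regulated T g"
    and "a \<in> frac_domain T \<alpha>" and "b \<in> frac_domain T \<alpha>"
  shows "frac_integral T \<alpha> a b (\<lambda>t. p * f t + q * g t)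
    = p * frac_integral T \<alpha> a b f + q * frac_integral T \<alpha> a b g"
proof -
  let ?F = "indef_frac_integral T \<alpha>"
  have "pre_antiderivative (frac_domain T \<alpha>) (\<lambda>t. (p * f t + q * g t) * frac_weight \<alpha> t)
      (\<lambda>t. p * ?F f t + q * ?F g t)"
    using pre_antiderivative_linear_combination[OF
        indef_frac_integral_pre_antiderivative[OF assms(1,2)]
        indef_frac_integral_pre_antiderivative[OF assms(1,3)], of \<alpha> p q]
    by (simp add: algebra_simps)
  from frac_integral_eq[OF assms(1) regulated_linear_combination[OF assms(2,3)] this assms(4,5)]
  show ?thesis by (simp add: frac_integral_def algebra_simps)
qed

lemma frac_integral_nonneg:
  assumes "closed T" and "regulated T f"
    and "a \<in> frac_domain T \<alpha>" and "b \<in> frac_domain T \<alpha>" and "a \<le> b"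
    and "\<And>t. t \<in> T \<inter> {a..b} \<Longrightarrow> 0 \<le> f t"
  shows "0 \<le> frac_integral T \<alpha> a b f"
proof -
  have "indef_frac_integral T \<alpha> f a \<le> indef_frac_integral T \<alpha> f b"
  proof (rule pre_antiderivative_mono[OF closed_upwards_frac_domain[OF assms(1)]
        indef_frac_integral_pre_antiderivative[OF assms(1,2)] assms(3-5)])
    fix t assume "t \<in> frac_domain T \<alpha> \<inter> {a..b}"
    then have "0 \<le> f t" by (intro assms(6)) (auto simp: frac_domain_def split: if_splits)
    then show "0 \<le> f t * frac_weight \<alpha> t" by (simp add: frac_weight_nonneg)
  qed
  then show ?thesis by (simp add: frac_integral_def)
qed

theorem theorem31:
  fixes T :: "real set" and \<alpha> a b c l :: real and f g :: "real \<Rightarrow> real"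
  assumes "time_scale T"
    and "0 < \<alpha>" and "\<alpha> \<le> 1"
    and "a \<in> T" and "b \<in> T" and "c \<in> T"
    and "\<alpha> = 1 \<or> (0 < a \<and> 0 < b \<and> 0 < c)"
    and "rd_continuous T f" and "rd_continuous T g"
  shows "frac_integral T \<alpha> a b (\<lambda>t. f t + g t) = frac_integral T \<alpha> a b f + frac_integral T \<alpha> a b g
    \<and> frac_integral T \<alpha> a b (\<lambda>t. l * f t) = l * frac_integral T \<alpha> a b f
    \<and> frac_integral T \<alpha> a b f = - frac_integral T \<alpha> b a f
    \<and> frac_integral T \<alpha> a b f = frac_integral T \<alpha> a c f + frac_integral T \<alpha> c b f
    \<and> frac_integral T \<alpha> a a f = 0
    \<and> (a \<le> b \<longrightarrow> (\<forall>h. regulated T h \<longrightarrow> (\<forall>t \<in> T \<inter> {a..b}. \<bar>f t\<bar> \<le> h t) \<longrightarrow>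
         \<bar>frac_integral T \<alpha> a b f\<bar> \<le> frac_integral T \<alpha> a b h))
    \<and> (a \<le> b \<longrightarrow> (\<forall>t \<in> T \<inter> {a..b}. f t > 0) \<longrightarrow> frac_integral T \<alpha> a b f \<ge> 0)"
proof (intro conjI impI allI)
  have T: "closed T" using assms(1) by (simp add: time_scale_def)
  have ab: "a \<in> frac_domain T \<alpha>" "b \<in> frac_domain T \<alpha>"
    using assms(4,5,7) by (auto simp: frac_domain_def)
  have f: "regulated T f" and g: "regulated T g"
    using assms(8,9) by (simp_all add: rd_continuous_imp_regulated)
  show "frac_integral T \<alpha> a b (\<lambda>t. f t + g t) = frac_integral T \<alpha> a b f + frac_integral T \<alpha> a b g"
    using frac_integral_linear_combination[OF T f g ab, of 1 1] by simp
  show "frac_integral T \<alpha> a b (\<lambda>t. l * f t) = l * frac_integral T \<alpha> a b f"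
    using frac_integral_linear_combination[OF T f f ab, of l 0] by simp
  show "frac_integral T \<alpha> a b f = - frac_integral T \<alpha> b a f"
    and "frac_integral T \<alpha> a b f = frac_integral T \<alpha> a c f + frac_integral T \<alpha> c b f"
    and "frac_integral T \<alpha> a a f = 0"
    by (simp_all add: frac_integral_def)
  show "0 \<le> frac_integral T \<alpha> a b f" if "a \<le> b" "\<forall>t \<in> T \<inter> {a..b}. f t > 0"
    using that by (intro frac_integral_nonneg[OF T f ab]) (auto intro: less_imp_le)
  show "\<bar>frac_integral T \<alpha> a b f\<bar> \<le> frac_integral T \<alpha> a b h"
    if "a \<le> b" and h: "regulated T h" and le: "\<forall>t \<in> T \<inter> {a..b}. \<bar>f t\<bar> \<le> h t" for h
  proof -
    \<comment> \<open>Both \<open>h + f\<close> and \<open>h - f\<close> are nonnegative on the interval.\<close>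
    have "0 \<le> frac_integral T \<alpha> a b (\<lambda>t. 1 * h t + q * f t)" if "\<bar>q\<bar> = 1" for q
    proof (intro frac_integral_nonneg[OF T regulated_linear_combination[OF h f] ab \<open>a \<le> b\<close>])
      fix t assume "t \<in> T \<inter> {a..b}"
      then have "\<bar>q * f t\<bar> \<le> h t" using le that by (simp add: abs_mult)
      then show "0 \<le> 1 * h t + q * f t" by linarith
    qed
    from this[of 1] this[of "-1"] show ?thesis
      unfolding frac_integral_linear_combination[OF T h f ab] by simp
  qed
qed

end
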